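(* Let $n\ge 3$ be an integer. For any non-zero vector $D=(\mathcal{W}_0,\mathcal{W}_1,\ldots,\mathcal{W}_n)\in\mathbb{C}^{n+1}$ one has $$\sum_{j=1}^{\infty}\frac1j\sum_{k=0}^{j}\binom{j}{k}\frac{(-1)^ka(n,k,D)}{\|D\|^{2k}}\left(\frac{1}{(n+1)^k}-\frac{1}{k!}\right)=\log(n+1)+\gamma,$$ where $\gamma$ denotes the Euler constant.
   Context: $\|D\|^2=|\mathcal{W}_0|^2+\cdots+|\mathcal{W}_n|^2$, and for integers $k\ge 0$, $$a(n,k,D)=\sum_{\substack{\ell_0+\cdots+\ell_n=k\\ \ell_m\ge 0}}\binom{k}{\ell_0,\ldots,\ell_n}^2|\mathcal{W}_0|^{2\ell_0}\cdots|\mathcal{W}_n|^{2\ell_n},\qquad \binom{k}{\ell_0,\ldots,\ell_n}=\frac{k!}{\ell_0!\cdots\ell_n!}.$$ *)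

theory Defs
  imports "HOL-Analysis.Analysis"
begin

definition multinomial :: "nat \<Rightarrow> ('m::finite \<Rightarrow> nat) \<Rightarrow> real" where
  "multinomial k l = fact k / (\<Prod>m\<in>UNIV. fact (l m))"

(* The coordinates W_0, ..., W_n of D are indexed by a finite type with n + 1
   elements, so n is determined by the type of D. The expression is symmetric in the
   coordinates, so the choice of labels is immaterial. *)
definition a_coeff :: "nat \<Rightarrow> complex ^ 'm::finite \<Rightarrow> real" where
  "a_coeff k D =
     (\<Sum>l | (\<Sum>m\<in>UNIV. l m) = k.
        (multinomial k l)\<^sup>2 * (\<Prod>m\<in>UNIV. cmod (D $ m) ^ (2 * l m)))"

(* The index set in a_coeff is finite, so the sum does not collapse to the default
   value 0. *)
lemma finite_compositions: "finite {l :: 'm::finite \<Rightarrow> nat. (\<Sum>m\<in>UNIV. l m) = k}"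
proof (rule finite_subset)
  show "{l :: 'm \<Rightarrow> nat. (\<Sum>m\<in>UNIV. l m) = k} \<subseteq> (UNIV :: 'm set) \<rightarrow>\<^sub>E {..k}"
    by (auto simp: member_le_sum)
  show "finite ((UNIV :: 'm set) \<rightarrow>\<^sub>E {..k})"
    by (intro finite_PiE) auto
qed

lemma norm_square_sum: "(norm D)\<^sup>2 = (\<Sum>m\<in>UNIV. (cmod (D $ m))\<^sup>2)"
  for D :: "complex ^ 'm::finite"
  by (simp add: norm_vec_def L2_set_def sum_nonneg)

end

theory Submission
  imports Defs "HOL-Real_Asymp.Real_Asymp"
begin

text \<open>
  Write \<open>Z\<close> for the sum of the \<open>W\<^sub>m U\<^sub>m\<close> with independent uniform unit complex numbers \<open>U\<^sub>m\<close>, and put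
  \<open>Y = |Z|\<^sup>2 / \<parallel>D\<parallel>\<^sup>2\<close> and \<open>c = n + 1\<close>. Then \<open>a(n,k,D)\<close> is the \<open>2k\<close>-th moment of \<open>|Z|\<close>, so the \<open>N\<close>-th
  partial sum of the series is the expectation of \<open>S\<^sub>N(Y)\<close>, where \<open>S\<^sub>N(y)\<close> is the sum of
  \<open>((1 - y/c)\<^sup>j - L\<^sub>j(y)) / j\<close> over \<open>1 \<le> j \<le> N\<close> and \<open>L\<^sub>j\<close> is the Laguerre polynomial. By Cauchy-Schwarz,
  \<open>0 \<le> Y \<le> c\<close>. On \<open>[0, c]\<close> the functions \<open>S\<^sub>N\<close> are uniformly bounded and they converge to \<open>ln c + \<gamma>\<close>
  uniformly away from \<open>0\<close>; since \<open>Y\<close> has no mass at \<open>0\<close>, the expectations converge to \<open>ln c + \<gamma>\<close>.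

  The sums \<open>G\<^sub>N\<close> of \<open>L\<^sub>j / j\<close> satisfy \<open>(G\<^sub>N + ln)' = L\<^sub>N(y) / y\<close>, and an energy estimate for the Laguerre
  equation shows that \<open>G\<^sub>N + ln\<close> is constant up to \<open>O(N\<^sup>-\<^sup>1\<^sup>/\<^sup>2)\<close>. Integrating against \<open>2 exp (-2y)\<close>, under
  which \<open>L\<^sub>j\<close> has mean \<open>2\<^sup>-\<^sup>j\<close>, identifies the constant as \<open>-\<gamma>\<close>.

  No measure theory is needed for \<open>Z\<close>: averaging each \<open>U\<^sub>m\<close> over the \<open>M\<close>-th roots of unity gives the same
  moments for \<open>k < M\<close>, so \<open>M = N + 1\<close> suffices for the \<open>N\<close>-th partial sum, and counting the roots
  of unity near a point bounds the mass of \<open>Y\<close> near \<open>0\<close>.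
\<close>

subsection \<open>Laguerre polynomials\<close>

definition laguerre :: "nat \<Rightarrow> real \<Rightarrow> real" where
  "laguerre N y = (\<Sum>k\<le>N. real (N choose k) * (- 1) ^ k / fact k * y ^ k)"

text \<open>The derivative of \<open>laguerre N\<close>, written so that bounds on it follow from
  bounds on the lower polynomials.\<close>

definition laguerre' :: "nat \<Rightarrow> real \<Rightarrow> real" where
  "laguerre' N y = - (\<Sum>i<N. laguerre i y)"

lemma laguerre_at_0 [simp]: "laguerre N 0 = 1"
  by (simp add: laguerre_def power_0_left if_distrib sum.delta cong: if_cong)

lemma laguerre_0 [simp]: "laguerre 0 y = 1"
  by (simp add: laguerre_def)

text \<open>Pascal's rule collapses the coefficient difference. The right-hand side is a termwise
  antiderivative of - L_N, which supplies the induction step for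
  \<open>DERIV_laguerre\<close>.\<close>

lemma laguerre_Suc_diff:
  "laguerre (Suc N) y - laguerre N y
     = (\<Sum>k\<le>N. real (N choose k) * (- 1) ^ Suc k / fact (Suc k) * y ^ Suc k)"
proof -
  have "laguerre N y = (\<Sum>k\<le>Suc N. real (N choose k) * (- 1) ^ k / fact k * y ^ k)"
    by (simp add: laguerre_def)
  then have "laguerre (Suc N) y - laguerre N y
      = (\<Sum>k\<le>Suc N. (real (Suc N choose k) - real (N choose k)) * (- 1) ^ k / fact k * y ^ k)"
    by (simp only: laguerre_def flip: sum_subtractf)
       (auto intro!: sum.cong simp: algebra_simps diff_divide_distrib)
  also have "\<dots> = (\<Sum>k\<le>N. real (N choose k) * (- 1) ^ Suc k / fact (Suc k) * y ^ Suc k)"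
    by (subst sum.atMost_Suc_shift) simp
  finally show ?thesis .
qed

lemma DERIV_laguerre: "(laguerre N has_real_derivative laguerre' N y) (at y)"
proof (induction N)
  case 0
  show ?case by (simp add: laguerre'_def laguerre_def)
next
  case (Suc N)
  have "((\<lambda>y. \<Sum>k\<le>N. real (N choose k) * (- 1) ^ Suc k / fact (Suc k) * y ^ Suc k)
      has_real_derivative
      (\<Sum>k\<le>N. real (N choose k) * (- 1) ^ Suc k / fact (Suc k) * (real (Suc k) * y ^ k))) (at y)"
    using DERIV_pow[of "Suc _" y] by (intro DERIV_sum DERIV_cmult) simp
  also have "(\<Sum>k\<le>N. real (N choose k) * (- 1) ^ Suc k / fact (Suc k) * (real (Suc k) * y ^ k))
      = - laguerre N y"
    unfolding laguerre_def sum_negf[symmetric]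
    by (intro sum.cong refl) (simp del: of_nat_Suc)
  finally have "((\<lambda>y. laguerre N y + (\<Sum>k\<le>N. real (N choose k) * (- 1) ^ Suc k / fact (Suc k) * y ^ Suc k))
      has_real_derivative laguerre' N y + - laguerre N y) (at y)"
    by (rule DERIV_add[OF Suc])
  moreover have "(\<lambda>y. laguerre N y + (\<Sum>k\<le>N. real (N choose k) * (- 1) ^ Suc k / fact (Suc k) * y ^ Suc k))
      = laguerre (Suc N)"
    by (simp only: laguerre_Suc_diff[symmetric] fun_eq_iff) simp
  moreover have "laguerre' N y + - laguerre N y = laguerre' (Suc N) y"
    by (simp add: laguerre'_def)
  ultimately show ?case by simp
qed

lemmas DERIV_laguerre_comp [derivative_intros] = DERIV_chain2[OF DERIV_laguerre]

text \<open>Termwise differentiation and the absorption identity \<open>Suc_times_binomial\<close>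
  reproduce the series in \<open>laguerre_Suc_diff\<close>.\<close>

lemma laguerre'_rec:
  "y * laguerre' (Suc N) y = real (Suc N) * (laguerre (Suc N) y - laguerre N y)"
proof -
  have "(laguerre (Suc N) has_real_derivative
      (\<Sum>k\<le>Suc N. real (Suc N choose k) * (- 1) ^ k / fact k * (real k * y ^ (k - 1)))) (at y)"
    unfolding laguerre_def
    by (rule DERIV_sum) (auto intro!: derivative_eq_intros simp del: of_nat_Suc)
  with DERIV_laguerre have "laguerre' (Suc N) y
      = (\<Sum>k\<le>Suc N. real (Suc N choose k) * (- 1) ^ k / fact k * (real k * y ^ (k - 1)))"
    by (rule DERIV_unique)
  also have "\<dots> = (\<Sum>k\<le>N. real (Suc N choose Suc k) * (- 1) ^ Suc k / fact (Suc k) * (real (Suc k) * y ^ k))"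
    by (subst sum.atMost_Suc_shift) simp
  finally have "y * laguerre' (Suc N) y
      = (\<Sum>k\<le>N. real (Suc k * (Suc N choose Suc k)) * ((- 1) ^ Suc k / fact (Suc k) * y ^ Suc k))"
    by (simp only: sum_distrib_left of_nat_mult) (intro sum.cong refl, simp only: power_Suc ac_simps times_divide_eq_right times_divide_eq_left)
  also have "\<dots> = real (Suc N) * (laguerre (Suc N) y - laguerre N y)"
    unfolding laguerre_Suc_diff sum_distrib_left Suc_times_binomial
    by (intro sum.cong refl) (simp add: algebra_simps)
  finally show ?thesis .
qed

lemma DERIV_laguerre':
  "(laguerre' N has_real_derivative - (\<Sum>i<N. laguerre' i y)) (at y)"
  unfolding laguerre'_def[abs_def]
  by (auto intro!: derivative_eq_intros simp: laguerre'_def)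

text \<open>Laguerre's equation y L'' + (1 - y) L' + N L = 0, with L'' written as in
  \<open>DERIV_laguerre'\<close>. It comes from differentiating \<open>laguerre'_rec\<close> and
  using L_N' - L_{N-1}' = - L_{N-1}.\<close>

lemma laguerre_ode:
  "y * (- (\<Sum>i<N. laguerre' i y)) = (y - 1) * laguerre' N y - real N * laguerre N y"
proof (cases N)
  case 0
  then show ?thesis by (simp add: laguerre'_def)
next
  case (Suc M)
  have "((\<lambda>y. y * laguerre' N y) has_real_derivative
      1 * laguerre' N y + (- (\<Sum>i<N. laguerre' i y)) * y) (at y)"
    by (rule DERIV_mult[OF DERIV_ident DERIV_laguerre'])
  moreover have "((\<lambda>y. real N * (laguerre N y - laguerre M y)) has_real_derivative
      real N * (laguerre' N y - laguerre' M y)) (at y)"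
    by (intro DERIV_cmult DERIV_diff DERIV_laguerre)
  ultimately have "1 * laguerre' N y + (- (\<Sum>i<N. laguerre' i y)) * y
      = real N * (laguerre' N y - laguerre' M y)"
    unfolding Suc laguerre'_rec by (rule DERIV_unique)
  moreover have "laguerre' N y - laguerre' M y = - laguerre M y"
    by (simp add: Suc laguerre'_def)
  moreover have "y * laguerre' N y = real N * (laguerre N y - laguerre M y)"
    unfolding Suc by (rule laguerre'_rec)
  ultimately show ?thesis by (simp add: algebra_simps)
qed

text \<open>By Laguerre's equation the left-hand side F satisfies F' = (2 y - 1) L'^2 / N, which is
  at most 2 F. So exp (- 2 y) F(y) decreases from its value 1 at 0.\<close>

lemma laguerre_energy:
  assumes "N \<ge> 1" "y \<ge> 0"
  shows "(laguerre N y)\<^sup>2 + y * (laguerre' N y)\<^sup>2 / N \<le> exp (2 * y)"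
proof -
  define F where "F y = (laguerre N y)\<^sup>2 + y * (laguerre' N y)\<^sup>2 / N" for y
  define l2 where "l2 y = - (\<Sum>i<N. laguerre' i y)" for y
  have F': "(F has_real_derivative (2 * y - 1) * (laguerre' N y)\<^sup>2 / N) (at y)" for y
  proof -
    have 1: "((\<lambda>y. (laguerre N y)\<^sup>2) has_real_derivative 2 * laguerre N y * laguerre' N y) (at y)"
      by (auto intro!: derivative_eq_intros)
    have 2: "((\<lambda>y. y * (laguerre' N y)\<^sup>2) has_real_derivative
        (laguerre' N y)\<^sup>2 + y * (2 * laguerre' N y * l2 y)) (at y)"
      unfolding l2_def by (auto intro!: derivative_eq_intros DERIV_laguerre')
    have "(F has_real_derivative 2 * laguerre N y * laguerre' N y
         + ((laguerre' N y)\<^sup>2 + y * (2 * laguerre' N y * l2 y)) / N) (at y)"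
      unfolding F_def[abs_def] by (rule DERIV_add[OF 1 DERIV_cdivide[OF 2]])
    moreover have "2 * laguerre N y * laguerre' N y
         + ((laguerre' N y)\<^sup>2 + y * (2 * laguerre' N y * l2 y)) / N
       = 2 * laguerre N y * laguerre' N y
         + ((laguerre' N y)\<^sup>2 + 2 * laguerre' N y * (y * l2 y)) / N"
      by (simp add: algebra_simps)
    moreover have "\<dots> = (2 * y - 1) * (laguerre' N y)\<^sup>2 / N"
      unfolding l2_def laguerre_ode using assms(1)
      by (simp add: field_simps power2_eq_square)
    ultimately show ?thesis by simp
  qed
  have "exp (- 2 * y) * F y \<le> exp (- 2 * 0) * F 0"
  proof (rule DERIV_nonpos_imp_nonincreasing[OF assms(2)])
    fix u :: real assume u: "0 \<le> u" "u \<le> y"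
    have "((\<lambda>y. exp (- 2 * y) * F y) has_real_derivative
        exp (- 2 * u) * ((2 * u - 1) * (laguerre' N u)\<^sup>2 / N - 2 * F u)) (at u)"
      by (auto intro!: derivative_eq_intros F' simp: algebra_simps)
    moreover have "(2 * u - 1) * (laguerre' N u)\<^sup>2 / N - 2 * F u
        = - (laguerre' N u)\<^sup>2 / N - 2 * (laguerre N u)\<^sup>2"
      using assms(1) by (simp add: F_def field_simps)
    moreover have "\<dots> \<le> 0"
      by (simp add: order.trans[of _ 0])
    ultimately show "\<exists>d. ((\<lambda>y. exp (- 2 * y) * F y) has_real_derivative d) (at u) \<and> d \<le> 0"
      by (metis mult_nonneg_nonpos exp_ge_zero)
  qed
  then have "F y \<le> exp (2 * y)" by (simp add: F_def exp_minus field_simps)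
  then show ?thesis by (simp add: F_def)
qed

lemma abs_laguerre_le:
  assumes "y \<ge> 0"
  shows "\<bar>laguerre N y\<bar> \<le> exp y"
proof (cases "N = 0")
  case False
  then have "(laguerre N y)\<^sup>2 \<le> exp (2 * y)"
    using laguerre_energy[of N y] assms
    by (smt (verit) divide_nonneg_nonneg mult_nonneg_nonneg of_nat_0_le_iff zero_le_power2
        less_one linorder_not_le)
  also have "exp (2 * y) = (exp y)\<^sup>2" by (simp add: exp_double)
  finally show ?thesis by (simp add: abs_le_square_iff[symmetric])
qed (use assms in auto)

lemma abs_laguerre'_le:
  assumes "y > 0" "N \<ge> 1"
  shows "\<bar>laguerre' N y\<bar> \<le> exp y * sqrt N / sqrt y"
proof -
  have "y * (laguerre' N y)\<^sup>2 / N \<le> exp (2 * y)"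
    using laguerre_energy[of N y] assms by (smt (verit) zero_le_power2)
  then have "(laguerre' N y)\<^sup>2 \<le> (exp y)\<^sup>2 * N / y"
    using assms by (simp add: field_simps flip: exp_double)
  also have "\<dots> = (exp y * sqrt N / sqrt y)\<^sup>2"
    using assms by (simp add: power_mult_distrib power_divide)
  finally have "\<bar>laguerre' N y\<bar> \<le> \<bar>exp y * sqrt N / sqrt y\<bar>" by (simp only: abs_le_square_iff)
  then show ?thesis using assms by simp
qed

text \<open>A mean value estimate. The factor N y makes it useful for y below 1 / N, where the
  logarithmic approximation degenerates.\<close>

lemma abs_laguerre_diff_1_le:
  assumes "y \<ge> 0"
  shows "\<bar>laguerre N y - 1\<bar> \<le> N * y * exp y"
proof -
  have "norm (laguerre N y - laguerre N 0) \<le> (N * exp y) * norm (y - 0)"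
  proof (rule field_differentiable_bound[of "{0..y}" _ "laguerre' N"])
    fix u assume u: "u \<in> {0..y}"
    show "(laguerre N has_field_derivative laguerre' N u) (at u within {0..y})"
      by (rule has_field_derivative_at_within[OF DERIV_laguerre])
    have "\<bar>laguerre' N u\<bar> \<le> (\<Sum>i<N. \<bar>laguerre i u\<bar>)" by (simp add: laguerre'_def)
    also have "\<dots> \<le> (\<Sum>i<N. exp y)"
      using u by (intro sum_mono order.trans[OF abs_laguerre_le]) auto
    finally show "norm (laguerre' N u) \<le> N * exp y" by simp
  qed (use assms in auto)
  then show ?thesis using assms by (simp add: mult_ac)
qed

section \<open>Logarithmic approximation of the sums of L_j / j\<close>

definition laguerre_sum :: "nat \<Rightarrow> real \<Rightarrow> real" where
  "laguerre_sum N y = (\<Sum>j=1..N. laguerre j y / j)"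

text \<open>Since y L_j' / j = L_j - L_{j-1}, the differentiated sum telescopes to L_N - L_0 over
  y.\<close>

lemma laguerre_sum_deriv:
  assumes "y > 0"
  shows "(laguerre_sum N has_real_derivative (laguerre N y - 1) / y) (at y)"
proof -
  have 1: "(laguerre_sum N has_real_derivative (\<Sum>j=1..N. laguerre' j y / j)) (at y)"
    unfolding laguerre_sum_def[abs_def]
    by (rule DERIV_sum) (intro DERIV_cdivide DERIV_laguerre)
  have eq: "y * (\<Sum>j=1..N. laguerre' j y / j) = laguerre N y - 1"
  proof (induction N)
    case (Suc N)
    have "y * (\<Sum>j=1..Suc N. laguerre' j y / j)
        = y * (\<Sum>j=1..N. laguerre' j y / j) + (y * laguerre' (Suc N) y) / Suc N"
      by (simp add: ring_distribs)
    also have "\<dots> = laguerre (Suc N) y - 1"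
      unfolding laguerre'_rec Suc by (simp del: of_nat_Suc)
    finally show ?case .
  qed simp
  have "(\<Sum>j=1..N. laguerre' j y / j) = (laguerre N y - 1) / y"
    using eq assms by (metis nonzero_mult_div_cancel_left less_irrefl)
  with 1 show ?thesis by simp
qed

text \<open>
  The derivative \<^term>\<open>laguerre N y / y\<close> of \<^term>\<open>laguerre_sum N y + ln y\<close> is merely bounded in \<^term>\<open>N\<close>. By the
  differential equation, adding the small term \<^term>\<open>(laguerre' N y - laguerre N y) / N\<close> turns it into
  \<^term>\<open>- laguerre' N y / (y * N)\<close>, which the energy estimate makes \<open>O(N\<^sup>-\<^sup>1\<^sup>/\<^sup>2)\<close>.
\<close>

lemma laguerre_sum_log_approx:
  assumes "y > 0" "N \<ge> 1"
  shows "\<bar>laguerre_sum N y + ln y - laguerre_sum N 1\<bar>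
           \<le> 11 * exp y * (1 + 1 / sqrt y) / sqrt N"
proof -
  define \<psi> where "\<psi> y = laguerre_sum N y + ln y + (laguerre' N y - laguerre N y) / N" for y
  \<comment> \<open>A majorant: \<open>h\<close> vanishes at 1, and its derivative dominates exp u /
    (u sqrt u), so its increments control those of \<open>\<psi>\<close>.\<close>
  define h where "h u = 4 * exp u * (1 - 1 / sqrt u)" for u :: real
  have N: "real N > 0" using assms by simp
  have d\<psi>: "(\<psi> has_real_derivative - laguerre' N u / (u * N)) (at u)" if "u > 0" for u
  proof -
    define l2 where "l2 = - (\<Sum>i<N. laguerre' i u)"
    have l2: "l2 = ((u - 1) * laguerre' N u - real N * laguerre N u) / u"
      using laguerre_ode[of u N] that unfolding l2_def by (simp add: field_simps)
    have "(\<psi> has_real_derivative (laguerre N u - 1) / u + 1 / u + (l2 - laguerre' N u) / N) (at u)"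
      unfolding \<psi>_def[abs_def] l2_def using that N
      by (intro DERIV_add DERIV_diff DERIV_cdivide laguerre_sum_deriv DERIV_laguerre DERIV_laguerre')
        (auto intro!: derivative_eq_intros)
    moreover have "(laguerre N u - 1) / u + 1 / u + (l2 - laguerre' N u) / N = - laguerre' N u / (u * N)"
      unfolding l2 using that N by (simp add: divide_simps) (simp add: algebra_simps)
    ultimately show ?thesis by simp
  qed
  have \<psi>': "\<bar>- laguerre' N u / (u * N)\<bar> \<le> exp u / (u * sqrt u) / sqrt N" if "u > 0" for u
  proof -
    have "\<bar>- laguerre' N u / (u * N)\<bar> = \<bar>laguerre' N u\<bar> / (u * N)"
      using that by (simp add: abs_mult)
    also have "\<dots> \<le> (exp u * sqrt N / sqrt u) / (u * N)"
      using that abs_laguerre'_le[OF that assms(2)] by (intro divide_right_mono) auto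
    also have "\<dots> = exp u / (u * sqrt u) / sqrt N"
      using that N by (simp add: field_simps)
    finally show ?thesis .
  qed
  have dh: "(h has_real_derivative 4 * exp u * (1 - 1 / sqrt u + 1 / (2 * u * sqrt u))) (at u)"
    if "u > 0" for u
    unfolding h_def[abs_def] using that
    by (auto intro!: derivative_eq_intros simp: field_simps)
  have h': "exp u / (u * sqrt u) \<le> 4 * exp u * (1 - 1 / sqrt u + 1 / (2 * u * sqrt u))" if "u > 0" for u
  proof -
    define s where "s = 1 / sqrt u"
    have s: "s > 0" "u = 1 / s\<^sup>2" "sqrt u = 1 / s"
      using that by (auto simp: s_def field_simps)
    \<comment> \<open>The product expands to s^3 - 4.32 s + 3.456, which lies below s^3 - 4 s + 4
      for s > 0. The double root 6/5 is close to the minimum of that cubic, at 2 / sqrt 3.\<close>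
    have "(s + 12 / 5) * (s - 6 / 5)\<^sup>2 \<ge> 0" using s by simp
    then have "s ^ 3 - 4 * s + 4 \<ge> 0"
      using s(1) by (simp add: field_simps power2_eq_square power3_eq_cube)
    then have "s ^ 3 \<le> 4 * (1 - s + s ^ 3 / 2)" by simp
    moreover have "1 / (u * sqrt u) = s ^ 3"
      using s by (simp add: power2_eq_square power3_eq_cube)
    moreover have "1 / (2 * u * sqrt u) = s ^ 3 / 2"
      using s by (simp add: power2_eq_square power3_eq_cube)
    ultimately have "1 / (u * sqrt u) \<le> 4 * (1 - 1 / sqrt u + 1 / (2 * u * sqrt u))"
      by (simp only: flip: s_def)
    then have "exp u * (1 / (u * sqrt u)) \<le> exp u * (4 * (1 - 1 / sqrt u + 1 / (2 * u * sqrt u)))"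
      by (intro mult_left_mono) auto
    then show ?thesis by (simp add: mult_ac)
  qed
  have mono: "\<bar>\<psi> b - \<psi> a\<bar> \<le> (h b - h a) / sqrt N" if "0 < a" "a \<le> b" for a b
  proof -
    \<comment> \<open>The signs \<sigma> = 1 and \<sigma> = -1 give the two halves of the absolute
      value.\<close>
    have "\<sigma> * \<psi> a + h a / sqrt N \<le> \<sigma> * \<psi> b + h b / sqrt N" if "\<bar>\<sigma>\<bar> = 1" for \<sigma> :: real
    proof (rule DERIV_nonneg_imp_nondecreasing[OF \<open>a \<le> b\<close>])
      fix u assume "a \<le> u" "u \<le> b"
      then have u: "u > 0" using \<open>0 < a\<close> by simp
      define p where "p = - laguerre' N u / (u * N)"
      define q where "q = 4 * exp u * (1 - 1 / sqrt u + 1 / (2 * u * sqrt u))"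
      have "((\<lambda>u. \<sigma> * \<psi> u + h u / sqrt N) has_real_derivative \<sigma> * p + q / sqrt N) (at u)"
        unfolding p_def q_def by (intro DERIV_add DERIV_cmult DERIV_cdivide d\<psi> dh u)
      moreover have "\<bar>\<sigma> * p\<bar> \<le> q / sqrt N"
        using \<psi>'[OF u] divide_right_mono[OF h'[OF u], of "sqrt N"] that
        by (simp add: abs_mult p_def q_def)
      ultimately show "\<exists>d. ((\<lambda>u. \<sigma> * \<psi> u + h u / sqrt N) has_real_derivative d) (at u) \<and> 0 \<le> d"
        by (intro exI[of _ "\<sigma> * p + q / sqrt N"]) auto
    qed
    from this[of 1] this[of "-1"] show ?thesis by (simp add: diff_divide_distrib abs_le_iff)
  qed
  have w1: "1 \<le> exp y * (1 + 1 / sqrt y)"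
    using assms mult_mono[of 1 "exp y" 1 "1 + 1 / sqrt y"] by simp
  have "h 1 = 0" by (simp add: h_def)
  then have "\<bar>\<psi> y - \<psi> 1\<bar> \<le> (- h y) / sqrt N \<or> \<bar>\<psi> y - \<psi> 1\<bar> \<le> h y / sqrt N"
    using mono[of y 1] mono[of 1 y] assms by (cases "y \<le> 1") (auto simp: abs_minus_commute)
  moreover have "(- h y) / sqrt N \<le> \<bar>h y\<bar> / sqrt N" "h y / sqrt N \<le> \<bar>h y\<bar> / sqrt N"
    by (intro divide_right_mono; simp)+
  ultimately have "\<bar>\<psi> y - \<psi> 1\<bar> \<le> \<bar>h y\<bar> / sqrt N" by linarith
  also have "\<bar>h y\<bar> \<le> 4 * exp y * (1 + 1 / sqrt y)"
    unfolding h_def abs_mult using assms by (intro mult_mono) (auto simp: abs_if)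
  finally have 1: "\<bar>\<psi> y - \<psi> 1\<bar> \<le> 4 * exp y * (1 + 1 / sqrt y) / sqrt N"
    by (simp add: divide_right_mono)
  have corr: "\<bar>(laguerre' N u - laguerre N u) / N\<bar> \<le> exp u * (1 + 1 / sqrt u) / sqrt N"
    if "u > 0" for u
  proof -
    have "\<bar>(laguerre' N u - laguerre N u) / N\<bar> \<le> (exp u * sqrt N / sqrt u + exp u) / N"
      using abs_laguerre'_le[OF that assms(2)] abs_laguerre_le[of u N] that
      by (auto simp: intro!: divide_right_mono)
    also have "\<dots> = exp u * (1 / sqrt N + 1 / sqrt u) / sqrt N"
      using N that by (simp add: field_simps)
    also have "\<dots> \<le> exp u * (1 + 1 / sqrt u) / sqrt N"
      using assms by (intro divide_right_mono mult_left_mono add_right_mono) auto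
    finally show ?thesis .
  qed
  \<comment> \<open>The correction at 1 is at most 2 exp 1 / sqrt N, hence the constant 6; the final
    11 is 4 + 1 + 6.\<close>
  have "exp (1::real) \<le> 3" using exp_le by simp
  then have "exp 1 * (1 + 1 / sqrt 1) / sqrt N \<le> 6 * (exp y * (1 + 1 / sqrt y)) / sqrt N"
    using w1 by (intro divide_right_mono) auto
  then have 2: "\<bar>(laguerre' N 1 - laguerre N 1) / N\<bar> \<le> 6 * (exp y * (1 + 1 / sqrt y)) / sqrt N"
    using corr[of 1] by linarith
  have "laguerre_sum N y + ln y - laguerre_sum N 1
      = (\<psi> y - \<psi> 1) - (laguerre' N y - laguerre N y) / N + (laguerre' N 1 - laguerre N 1) / N"
    by (simp add: \<psi>_def)
  also have "\<bar>\<dots>\<bar> \<le> 4 * exp y * (1 + 1 / sqrt y) / sqrt N + exp y * (1 + 1 / sqrt y) / sqrt N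
      + 6 * (exp y * (1 + 1 / sqrt y)) / sqrt N"
    by (rule order.trans[OF abs_triangle_ineq add_mono[OF order.trans[OF abs_triangle_ineq4
          add_mono[OF 1 corr[OF assms(1)]]] 2]])
  also have "\<dots> = 11 * exp y * (1 + 1 / sqrt y) / sqrt N"
    by (simp add: add_divide_distrib[symmetric])
  finally show ?thesis .
qed

section \<open>Gamma integrals and the identification of the constant\<close>

lemma Gamma_integral_real_open:
  assumes "x > (0 :: real)"
  shows "((\<lambda>t. t powr (x - 1) / exp t) has_integral Gamma x) {0<..}"
proof -
  have "{0..} - {0::real<..} = {0}" "{0::real<..} - {0..} = {}" by auto
  then show ?thesis
    using Gamma_integral_real[OF assms]
    by (subst has_integral_spike_set_eq[where T = "{0..}"]) (auto intro: negligible_subset[of "{0}"])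
qed

text \<open>The moments k! cancel the factorials in L_j and leave the binomial expansion of (1 -
  1/2)^j. This is the mean under 2 exp (- 2 y) after rescaling; halving the argument leaves a factor
  exp (- y / 2) against errors that grow like exp (y / 2).\<close>

lemma has_integral_laguerre_half:
  "((\<lambda>y. laguerre j (y / 2) / exp y) has_integral (1 / 2) ^ j) {0<..}"
proof -
  have 1: "((\<lambda>y. y ^ k / exp y) has_integral (fact k :: real)) {0<..}" for k
  proof (rule has_integral_eq[rotated])
    show "((\<lambda>y. y powr ((real k + 1) - 1) / exp y) has_integral (fact k :: real)) {0<..}"
      using Gamma_integral_real_open[of "real k + 1"] by (simp add: Gamma_fact[symmetric] add.commute)
  qed (simp add: powr_realpow)
  have "((\<lambda>y. \<Sum>k\<le>j. real (j choose k) * (- 1 / 2) ^ k / fact k * (y ^ k / exp y)) has_integral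
      (\<Sum>k\<le>j. real (j choose k) * (- 1 / 2) ^ k / fact k * fact k)) {0<..}"
    by (intro has_integral_sum has_integral_mult_right 1) auto
  moreover have "(\<Sum>k\<le>j. real (j choose k) * (- 1 / 2) ^ k / fact k * fact k) = (- 1 / 2 + 1 :: real) ^ j"
    by (subst binomial_ring) simp
  moreover have "(\<Sum>k\<le>j. real (j choose k) * (- 1 / 2) ^ k / fact k * (y ^ k / exp y))
      = laguerre j (y / 2) / exp y" for y
    unfolding laguerre_def sum_divide_distrib
    by (intro sum.cong refl) (simp add: power_divide power_mult_distrib power_minus')
  ultimately show ?thesis by simp
qed

text \<open>This is Gamma'(1) = - \<gamma>, obtained without differentiating under the integral: h
  ln t \<le> t^h - 1 integrates to h I \<le> Gamma (1 + h) - 1, and dividing by small h of either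
  sign squeezes I between difference quotients of Gamma at 1.\<close>

lemma has_integral_ln_exp: "((\<lambda>t. ln t / exp t) has_integral - euler_mascheroni) {0::real<..}"
proof -
  have le: "h * ln t \<le> t powr h - 1" if "t > 0" for h t :: real
    using ln_le_minus_one[of "t powr h"] that by (simp add: ln_powr)
  \<comment> \<open>An integrable majorant: \<open>le\<close> with h = 1 and h = -1/2 bounds |ln t|
    by t + 2 / sqrt t.\<close>
  have "(\<lambda>t. t powr (2 - 1) / exp t + 2 * (t powr (1 / 2 - 1) / exp t)) integrable_on {0::real<..}"
    using Gamma_integral_real_open[of 2] Gamma_integral_real_open[of "1 / 2"]
    by (intro integrable_add integrable_on_mult_right) (auto simp: integrable_on_def)
  then have "(\<lambda>t. ln t / exp t) absolutely_integrable_on {0::real<..}"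
  proof (rule measurable_bounded_by_integrable_imp_absolutely_integrable[rotated 2])
    show "(\<lambda>t. ln t / exp t) \<in> borel_measurable (lebesgue_on {0::real<..})"
      by (intro continuous_imp_measurable_on_sets_lebesgue continuous_intros) auto
    fix t :: real assume "t \<in> {0<..}"
    then have t: "t > 0" by simp
    have "\<bar>ln t\<bar> \<le> t powr 1 + 2 * t powr (- 1 / 2)"
      using le[OF t, of 1] le[OF t, of "- 1 / 2"] powr_ge_zero[of t "- 1 / 2"] powr_ge_zero[of t 1]
      unfolding abs_le_iff by linarith
    then have "\<bar>ln t\<bar> / exp t \<le> (t powr 1 + 2 * t powr (- 1 / 2)) / exp t"
      by (rule divide_right_mono) simp
    then show "norm (ln t / exp t) \<le> t powr (2 - 1) / exp t + 2 * (t powr (1 / 2 - 1) / exp t)"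
      by (simp add: add_divide_distrib)
  qed auto
  then have "(\<lambda>t. ln t / exp t) integrable_on {0::real<..}"
    by (rule set_lebesgue_integral_eq_integral(1))
  then obtain I where I: "((\<lambda>t. ln t / exp t) has_integral I) {0::real<..}"
    by (auto simp: integrable_on_def)
  have Gamma: "h * I \<le> Gamma (1 + h) - 1" if "h > -1" for h :: real
  proof -
    have "((\<lambda>t. t powr (1 - 1) / exp t) has_integral (1 :: real)) {0<..}"
      using Gamma_integral_real_open[of 1] by simp
    then have "((\<lambda>t. t powr ((1 + h) - 1) / exp t - t powr (1 - 1) / exp t) has_integral
        Gamma (1 + h) - 1) {0<..}"
      using that by (intro has_integral_diff Gamma_integral_real_open) auto
    with has_integral_mult_right[OF I, of h] show ?thesis
    proof (rule has_integral_le)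
      fix t :: real assume "t \<in> {0<..}"
      then have "h * ln t / exp t \<le> (t powr h - 1) / exp t"
        by (intro divide_right_mono le) auto
      with \<open>t \<in> {0<..}\<close> show "h * (ln t / exp t) \<le> t powr ((1 + h) - 1) / exp t - t powr (1 - 1) / exp t"
        by (simp add: diff_divide_distrib)
    qed
  qed
  define q where "q h = (Gamma (1 + h) - Gamma 1) / h" for h :: real
  have "(Gamma has_real_derivative - euler_mascheroni) (at (1 :: real))"
    using has_field_derivative_Gamma[of "1 :: real"] by simp
  then have q: "(q \<longlongrightarrow> - euler_mascheroni) (at 0)"
    unfolding DERIV_def q_def[abs_def] .
  have "I \<le> - euler_mascheroni"
  proof (rule tendsto_lowerbound)
    show "(q \<longlongrightarrow> - euler_mascheroni) (at_right 0)"
      using q by (rule filterlim_mono) (auto simp: at_within_le_at)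
    show "eventually (\<lambda>h. I \<le> q h) (at_right 0)"
      using eventually_at_right_less[of 0]
      by eventually_elim (use Gamma in \<open>auto simp: q_def field_simps\<close>)
  qed auto
  moreover have "I \<ge> - euler_mascheroni"
  proof (rule tendsto_upperbound)
    show "(q \<longlongrightarrow> - euler_mascheroni) (at_left 0)"
      using q by (rule filterlim_mono) (auto simp: at_within_le_at)
    have "eventually (\<lambda>h. h \<in> {-1<..<0}) (at_left (0::real))"
      by (rule eventually_at_left_real) simp
    then show "eventually (\<lambda>h. q h \<le> I) (at_left 0)"
      by eventually_elim (use Gamma in \<open>auto simp: q_def field_simps\<close>)
  qed auto
  ultimately show ?thesis using I by simp
qed

text \<open>The error \<phi> has derivative (1 - u)^N / u and vanishes at 1, so it is nonpositive on
  (0, 1]. Adding 1 / (N u) makes it decreasing, because Bernoulli's inequality gives (1 - u)^N (1 +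
  N u) \<le> (1 - u^2)^N \<le> 1.\<close>

lemma log_series_approx:
  fixes x :: real
  assumes "0 < x" "x \<le> 1" "N \<ge> 1"
  shows "\<bar>(\<Sum>j=1..N. (1 - x) ^ j / j) + ln x\<bar> \<le> 1 / (N * x)"
proof -
  have N: "real N > 0" using assms by simp
  define \<phi> where "\<phi> x = (\<Sum>j=1..N. (1 - x) ^ j / j) + ln x" for x :: real
  have d: "(\<phi> has_real_derivative (1 - u) ^ N / u) (at u)" if "u > 0" for u
  proof -
    have "(\<phi> has_real_derivative (\<Sum>j=1..N. - ((1 - u) ^ (j - 1))) + 1 / u) (at u)"
      unfolding \<phi>_def[abs_def] using that
      by (intro DERIV_add DERIV_sum) (auto intro!: derivative_eq_intros)
    moreover have "u * (\<Sum>j=1..N. - ((1 - u) ^ (j - 1))) = (1 - u) ^ N - 1"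
      by (induction N) (auto simp: algebra_simps)
    then have "(\<Sum>j=1..N. - ((1 - u) ^ (j - 1))) + 1 / u = (1 - u) ^ N / u"
      using that by (simp add: field_simps)
    ultimately show ?thesis by simp
  qed
  have "\<phi> x \<le> \<phi> 1"
    using assms by (intro DERIV_nonneg_imp_nondecreasing[OF assms(2)]) (force intro: d)
  moreover define g where "g u = \<phi> u + 1 / (N * u)" for u :: real
  have "g 1 \<le> g x"
  proof (rule DERIV_nonpos_imp_nonincreasing[OF assms(2)])
    fix u assume "x \<le> u" "u \<le> 1"
    then have u: "0 < u" "u \<le> 1" using assms by auto
    have "(1 - u) ^ N * (1 + N * u) \<le> (1 - u) ^ N * (1 + u) ^ N"
      using Bernoulli_inequality[of u N] u by (intro mult_left_mono) auto
    also have "\<dots> = (1 - u\<^sup>2) ^ N"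
      by (simp add: power_mult_distrib[symmetric] power2_eq_square algebra_simps)
    also have "\<dots> \<le> 1"
      using u by (intro power_le_one) (auto simp: power_le_one)
    finally have "(1 - u) ^ N * (N * u) \<le> 1"
      using u zero_le_power[of "1 - u" N] unfolding ring_distribs by linarith
    then have "(1 - u) ^ N / u - 1 / (N * u\<^sup>2) \<le> 0"
      using u N by (simp add: field_simps power2_eq_square)
    moreover have "(g has_real_derivative (1 - u) ^ N / u - 1 / (N * u\<^sup>2)) (at u)"
      unfolding g_def[abs_def] using u N by (auto intro!: derivative_eq_intros d simp: field_simps power2_eq_square)
    ultimately show "\<exists>D. (g has_real_derivative D) (at u) \<and> D \<le> 0"
      by blast
  qed
  moreover have "\<phi> 1 = 0" by (auto simp: \<phi>_def power_0_left intro!: sum.neutral)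
  moreover have "0 \<le> 1 / real N" "0 \<le> 1 / (N * x)" using assms(1) by auto
  ultimately have "\<bar>\<phi> x\<bar> \<le> 1 / (N * x)"
    unfolding g_def abs_le_iff mult_1_right by linarith
  then show ?thesis by (simp add: \<phi>_def)
qed

text \<open>The approximation at y / 2 is integrated against exp (- y). The Laguerre part gives the
  partial sums of (1/2)^j / j, which tend to ln 2; the mean of ln (y / 2) is - \<gamma> - ln 2, and
  the two logarithms cancel.\<close>

lemma laguerre_sum_1_tendsto: "(\<lambda>N. laguerre_sum N 1) \<longlonglongrightarrow> - euler_mascheroni"
proof -
  \<comment> \<open>The y-dependent factor of the error bound at y / 2, multiplied by exp (-
    y).\<close>
  define w where "w y = exp (- (y / 2)) * (1 + sqrt 2 / sqrt y)" for y :: real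
  have "(\<lambda>y. y powr (z - 1) / exp (y / 2)) integrable_on {0::real<..}" if "z > 0" for z :: real
  proof -
    have "(\<lambda>t. norm (complex_of_real t powr (complex_of_real z - 1) / of_real (exp (1 / 2 * t)))) integrable_on {0<..}"
      using absolutely_integrable_Gamma_integral[of z "1 / 2"] that
      unfolding absolutely_integrable_on_def by simp
    then show ?thesis
      by (rule integrable_eq) (simp add: norm_divide norm_powr_real_powr)
  qed
  from this[of 1] this[of "1 / 2"]
  have "(\<lambda>y. y powr (1 - 1) / exp (y / 2) + sqrt 2 * (y powr (1 / 2 - 1) / exp (y / 2))) integrable_on {0::real<..}"
    by (intro integrable_add integrable_on_mult_right) auto
  then have "w integrable_on {0<..}"
    by (rule integrable_eq) (auto simp: w_def powr_minus powr_half_sqrt exp_minus field_simps)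
  then obtain J where J: "(w has_integral J) {0<..}" by (auto simp: integrable_on_def)
  have int1: "((\<lambda>y. 1 / exp y) has_integral (1::real)) {0<..}"
    using has_integral_laguerre_half[of 0] by simp
  have bound: "\<bar>(\<Sum>j=1..N. (1 / 2) ^ j / j) - euler_mascheroni - ln 2 - laguerre_sum N 1\<bar>
      \<le> 11 / sqrt N * J" if "N \<ge> 1" for N :: nat
  proof -
    define f where "f y = (laguerre_sum N (y / 2) + ln (y / 2) - laguerre_sum N 1) / exp y" for y
    have "((\<lambda>y. (\<Sum>j=1..N. laguerre j (y / 2) / exp y / j) + ln y / exp y
        - (ln 2 + laguerre_sum N 1) * (1 / exp y))
        has_integral (\<Sum>j=1..N. (1 / 2) ^ j / j) + (- euler_mascheroni) - (ln 2 + laguerre_sum N 1) * 1) {0<..}"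
      by (intro has_integral_diff has_integral_add has_integral_sum has_integral_mult_right
          has_integral_divide has_integral_laguerre_half has_integral_ln_exp int1) auto
    then have f: "(f has_integral (\<Sum>j=1..N. (1 / 2) ^ j / j) + (- euler_mascheroni) - (ln 2 + laguerre_sum N 1) * 1) {0<..}"
      by (rule has_integral_eq[rotated])
        (auto simp: f_def laguerre_sum_def sum_divide_distrib ln_div
            add_divide_distrib diff_divide_distrib divide_divide_eq_left mult.commute)
    have J': "((\<lambda>y. 11 / sqrt N * w y) has_integral 11 / sqrt N * J) {0<..}"
      by (rule has_integral_mult_right[OF J])
    have "norm (integral {0<..} f) \<le> integral {0<..} (\<lambda>y. 11 / sqrt N * w y)"
    proof (rule integral_norm_bound_integral)
      show "f integrable_on {0<..}" "(\<lambda>y. 11 / sqrt N * w y) integrable_on {0<..}"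
        using f J' by blast+
      fix y :: real assume "y \<in> {0<..}"
      then have y: "y > 0" by simp
      have "norm (f y) \<le> (11 * exp (y / 2) * (1 + 1 / sqrt (y / 2)) / sqrt N) / exp y"
        using laguerre_sum_log_approx[of "y / 2" N] y that
        by (auto simp: f_def abs_mult simp del: divide_divide_eq_left intro!: divide_right_mono)
      also have "\<dots> = 11 / sqrt N * ((exp (y / 2) / exp y) * (1 + 1 / sqrt (y / 2)))"
        by simp
      also have "exp (y / 2) / exp y = exp (- (y / 2))"
        by (simp flip: exp_diff)
      also have "11 / sqrt N * (exp (- (y / 2)) * (1 + 1 / sqrt (y / 2))) = 11 / sqrt N * w y"
        by (simp add: w_def real_sqrt_divide)
      finally show "norm (f y) \<le> 11 / sqrt N * w y" .
    qed
    then show ?thesis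
      unfolding integral_unique[OF f] integral_unique[OF J'] by (simp add: algebra_simps)
  qed
  have "(\<lambda>N. 11 / sqrt (real N) * J) \<longlonglongrightarrow> 0"
    by real_asymp
  then have "(\<lambda>N. (\<Sum>j=1..N. (1 / 2) ^ j / real j) - euler_mascheroni - ln 2 - laguerre_sum N 1) \<longlonglongrightarrow> 0"
    by (rule Lim_null_comparison[rotated]) (use bound in \<open>auto simp: eventually_at_top_linorder intro!: exI[of _ 1]\<close>)
  moreover have "(\<lambda>N. (\<Sum>j=1..N. (1 / 2) ^ j / real j)) \<longlonglongrightarrow> ln 2"
  proof (rule LIM_zero_cancel, rule Lim_null_comparison)
    show "eventually (\<lambda>N. norm ((\<Sum>j=1..N. (1 / 2) ^ j / real j) - ln 2) \<le> 2 / real N) sequentially"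
      using log_series_approx[of "1 / 2"]
      by (auto simp: eventually_at_top_linorder ln_div intro!: exI[of _ 1])
    show "(\<lambda>N. 2 / real N) \<longlonglongrightarrow> 0" by real_asymp
  qed
  ultimately have "(\<lambda>N. (\<Sum>j=1..N. (1 / 2) ^ j / real j) - euler_mascheroni - ln 2
      - ((\<Sum>j=1..N. (1 / 2) ^ j / real j) - euler_mascheroni - ln 2 - laguerre_sum N 1))
      \<longlonglongrightarrow> ln 2 - euler_mascheroni - ln 2 - 0"
    by (intro tendsto_intros)
  then show ?thesis by simp
qed

section \<open>Uniform estimates for the partial sums as functions of y\<close>

definition gap_sum :: "real \<Rightarrow> nat \<Rightarrow> real \<Rightarrow> real" where
  "gap_sum c N y = (\<Sum>j=1..N. ((1 - y / c) ^ j - laguerre j y) / j)"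

text \<open>The geometric part is close to ln c - ln y and the Laguerre part to - ln y - \<gamma>,
  so the singular logarithms cancel.\<close>

lemma gap_sum_approx:
  assumes "0 < y" "y \<le> c" "N \<ge> 1"
  shows "\<bar>gap_sum c N y - (ln c + euler_mascheroni)\<bar>
    \<le> c / (N * y) + 11 * exp c * (1 + 1 / sqrt y) / sqrt N + \<bar>laguerre_sum N 1 + euler_mascheroni\<bar>"
proof -
  have c: "c > 0" using assms by simp
  define q where "q = (\<Sum>j=1..N. (1 - y / c) ^ j / j)"
  have "\<bar>q + ln (y / c)\<bar> \<le> 1 / (N * (y / c))"
    unfolding q_def using assms c by (intro log_series_approx) auto
  then have 1: "\<bar>q + ln y - ln c\<bar> \<le> c / (N * y)"
    using assms c by (simp add: ln_div)
  have "11 * exp y * (1 + 1 / sqrt y) / sqrt N \<le> 11 * exp c * (1 + 1 / sqrt y) / sqrt N"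
    using assms by (intro divide_right_mono mult_right_mono) auto
  with laguerre_sum_log_approx[OF assms(1,3)]
  have 2: "\<bar>laguerre_sum N y + ln y - laguerre_sum N 1\<bar> \<le> 11 * exp c * (1 + 1 / sqrt y) / sqrt N"
    by linarith
  have "gap_sum c N y = q - laguerre_sum N y"
    by (simp add: gap_sum_def q_def laguerre_sum_def diff_divide_distrib sum_subtractf)
  then show ?thesis using 1 2 by linarith
qed

text \<open>Both polynomials equal 1 at y = 0, so each summand is O(y) uniformly in j. This serves
  the range N y < 1, where \<open>gap_sum_approx\<close> blows up.\<close>

lemma abs_gap_sum_le:
  assumes "0 \<le> y" "y \<le> c" "0 < c"
  shows "\<bar>gap_sum c N y\<bar> \<le> (N * y) * (1 / c + exp c)"
proof -
  have "\<bar>((1 - y / c) ^ j - laguerre j y) / j\<bar> \<le> y * (1 / c + exp c)" if "j \<in> {1..N}" for j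
  proof -
    have "1 - j * (y / c) \<le> (1 - y / c) ^ j"
      using Bernoulli_inequality[of "- (y / c)" j] assms by simp
    moreover have "(1 - y / c) ^ j \<le> 1"
      using assms by (intro power_le_one) auto
    moreover have "\<bar>laguerre j y - 1\<bar> \<le> j * y * exp c"
      using assms by (intro order.trans[OF abs_laguerre_diff_1_le] mult_left_mono) auto
    ultimately have "\<bar>(1 - y / c) ^ j - laguerre j y\<bar> \<le> j * (y / c) + j * y * exp c"
      by linarith
    then show ?thesis using that by (simp add: field_simps)
  qed
  then have "\<bar>gap_sum c N y\<bar> \<le> (\<Sum>j=1..N. y * (1 / c + exp c))"
    unfolding gap_sum_def by (intro order.trans[OF sum_abs] sum_mono)
  then show ?thesis by simp
qed

text \<open>The range is split at N y = 1: \<open>gap_sum_approx\<close> is bounded above the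
  threshold, \<open>abs_gap_sum_le\<close> below it.\<close>

lemma gap_sum_bounded:
  assumes "c > 0"
  obtains B where "\<And>N y. 0 \<le> y \<Longrightarrow> y \<le> c \<Longrightarrow> N \<ge> 1 \<Longrightarrow> \<bar>gap_sum c N y - (ln c + euler_mascheroni)\<bar> \<le> B"
proof -
  have "Bseq (\<lambda>N. laguerre_sum N 1 + euler_mascheroni)"
    by (intro convergent_imp_Bseq convergentI[of _ "- euler_mascheroni + euler_mascheroni"]
        tendsto_intros laguerre_sum_1_tendsto)
  then obtain D where D: "\<And>N. \<bar>laguerre_sum N 1 + euler_mascheroni\<bar> \<le> D"
    by (auto simp: Bseq_def)
  \<comment> \<open>The sum of the bounds from the two ranges; 22 is 11 times the bound 2 for (1 + 1
    / sqrt y) / sqrt N.\<close>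
  define B where "B = (c + 22 * exp c + D) + (1 / c + exp c + \<bar>ln c + euler_mascheroni\<bar>)"
  have nonneg: "0 \<le> 1 / c + exp c + \<bar>ln c + euler_mascheroni\<bar>" "0 \<le> c + 22 * exp c + D"
    using assms D[of 0] by (auto intro!: add_nonneg_nonneg)
  show thesis
  proof (rule that)
    fix N :: nat and y :: real assume y: "0 \<le> y" "y \<le> c" and N: "N \<ge> 1"
    show "\<bar>gap_sum c N y - (ln c + euler_mascheroni)\<bar> \<le> B"
    proof (cases "N * y \<ge> 1")
      case True
      then have "y > 0" using y by (cases "y = 0") auto
      have "c / (N * y) \<le> c" using True assms by (simp add: field_simps)
      moreover have "(1 + 1 / sqrt y) / sqrt N \<le> 2"
      proof -
        have "1 \<le> sqrt N * sqrt y" using True by (simp flip: real_sqrt_mult)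
        then have "1 / sqrt y / sqrt N \<le> 1" using \<open>y > 0\<close> N by (simp add: field_simps)
        moreover have "1 / sqrt N \<le> 1" using N by simp
        ultimately show ?thesis by (simp add: add_divide_distrib)
      qed
      then have "11 * exp c * ((1 + 1 / sqrt y) / sqrt N) \<le> 11 * exp c * 2"
        by (intro mult_left_mono) auto
      ultimately have "\<bar>gap_sum c N y - (ln c + euler_mascheroni)\<bar> \<le> c + 22 * exp c + D"
        using gap_sum_approx[OF \<open>y > 0\<close> y(2) N] D[of N] by simp
      then show ?thesis using nonneg by (simp add: B_def)
    next
      case False
      then have "(N * y) * (1 / c + exp c) \<le> 1 * (1 / c + exp c)"
        using assms by (intro mult_right_mono) (auto intro: add_nonneg_nonneg)
      with abs_gap_sum_le[OF y assms, of N] show ?thesis using nonneg by (simp add: B_def)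
    qed
  qed
qed

text \<open>The threshold 1 / sqrt N tends to 0, so little mass is cut off, yet it keeps N y \<ge>
  sqrt N, so the errors still vanish.\<close>

lemma gap_sum_uniform_limit:
  assumes "c > 0"
  obtains \<epsilon> :: "nat \<Rightarrow> real" where "\<epsilon> \<longlonglongrightarrow> 0"
    and "\<And>N y. 1 / sqrt N \<le> y \<Longrightarrow> y \<le> c \<Longrightarrow> N \<ge> 1 \<Longrightarrow>
           \<bar>gap_sum c N y - (ln c + euler_mascheroni)\<bar> \<le> \<epsilon> N"
proof
  define \<epsilon> where "\<epsilon> N = c / sqrt N + 11 * exp c * (1 + sqrt (sqrt N)) / sqrt N
      + \<bar>laguerre_sum N 1 + euler_mascheroni\<bar>" for N :: nat
  have 1: "(\<lambda>N. c / sqrt (real N) + 11 * exp c * (1 + sqrt (sqrt (real N))) / sqrt (real N)) \<longlonglongrightarrow> 0"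
    by real_asymp
  have 2: "(\<lambda>N. \<bar>laguerre_sum N 1 + euler_mascheroni\<bar>) \<longlonglongrightarrow> \<bar>- euler_mascheroni + euler_mascheroni\<bar>"
    by (intro tendsto_intros laguerre_sum_1_tendsto)
  show "\<epsilon> \<longlonglongrightarrow> 0"
    unfolding \<epsilon>_def[abs_def] using tendsto_add[OF 1 2] by simp
  fix N :: nat and y :: real assume y: "1 / sqrt N \<le> y" "y \<le> c" and N: "N \<ge> 1"
  have s: "sqrt N > 0" using N by simp
  then have "y > 0" using y by (smt (verit) divide_pos_pos)
  have sy: "1 \<le> sqrt N * y" using y(1) s by (simp add: field_simps)
  have "sqrt N * 1 \<le> sqrt N * (sqrt N * y)"
    using sy s by (intro mult_left_mono) auto
  then have "sqrt N \<le> N * y" by (simp flip: mult.assoc)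
  then have "c / (N * y) \<le> c / sqrt N"
    using assms s by (intro divide_left_mono) (auto intro: mult_pos_pos simp: \<open>y > 0\<close> N)
  moreover have "1 \<le> sqrt (sqrt N) * sqrt y" using sy by (simp flip: real_sqrt_mult)
  then have "1 / sqrt y \<le> sqrt (sqrt N)" using \<open>y > 0\<close> by (simp add: field_simps)
  then have "11 * exp c * (1 + 1 / sqrt y) / sqrt N \<le> 11 * exp c * (1 + sqrt (sqrt N)) / sqrt N"
    by (intro divide_right_mono mult_left_mono) auto
  ultimately show "\<bar>gap_sum c N y - (ln c + euler_mascheroni)\<bar> \<le> \<epsilon> N"
    using gap_sum_approx[OF \<open>y > 0\<close> y(2) N] by (simp add: \<epsilon>_def)
qed

subsection \<open>Averages over roots of unity\<close>

text \<open>A geometric sum whose ratio q satisfies q^M = 1. Exponents below M give distinct powers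
  of the primitive root, so q = 1 only for j = k.\<close>

lemma sum_roots_unity_orthogonal:
  assumes "j < M" "k < M"
  shows "(\<Sum>i<M. cis (2 * pi * real i / M) ^ j * cnj (cis (2 * pi * real i / M) ^ k))
    = (if j = k then of_nat M else 0)"
proof -
  define \<zeta> where "\<zeta> = cis (2 * pi / M)"
  define q where "q = \<zeta> ^ j * cnj (\<zeta> ^ k)"
  have M: "M > 0" using assms by simp
  have unit: "\<zeta> ^ l * cnj (\<zeta> ^ l) = 1" for l
    using complex_norm_square[of "\<zeta> ^ l"] by (simp add: \<zeta>_def norm_power)
  have "\<zeta> ^ M = 1" using Complex.DeMoivre[of "2 * pi / M" M] M by (simp add: \<zeta>_def)
  then have "q ^ M = 1"
    by (simp add: q_def power_mult_distrib flip: power_mult complex_cnj_power) (simp add: mult.commute[of _ M] power_mult)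
  have "cis (2 * pi * real i / M) = \<zeta> ^ i" for i
    by (simp add: \<zeta>_def Complex.DeMoivre mult_ac)
  then have "(\<Sum>i<M. cis (2 * pi * real i / M) ^ j * cnj (cis (2 * pi * real i / M) ^ k)) = (\<Sum>i<M. q ^ i)"
    by (simp add: q_def power_mult_distrib mult.commute flip: power_mult)
  also have "\<dots> = (if j = k then of_nat M else 0)"
  proof (cases "j = k")
    case True
    then have "q = 1" by (simp only: q_def unit)
    with True show ?thesis by simp
  next
    case False
    have "q \<noteq> 1"
    proof
      assume "q = 1"
      then have "\<zeta> ^ j * (\<zeta> ^ k * cnj (\<zeta> ^ k)) = \<zeta> ^ k"
        by (simp add: q_def mult_ac)
      then have "\<zeta> ^ j = \<zeta> ^ k" by (simp only: unit mult_1_right)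
      moreover have "\<zeta> ^ l = exp (2 * of_real pi * \<i> * of_nat l / of_nat M)" for l
        unfolding \<zeta>_def Complex.DeMoivre unfolding cis_conv_exp by (simp add: mult_ac)
      ultimately have "exp (2 * of_real pi * \<i> * of_nat j / of_nat M) = exp (2 * of_real pi * \<i> * of_nat k / of_nat M)"
        by simp
      then show False
        using complex_root_unity_eq[of M j k] M assms False by simp
    qed
    then show ?thesis using \<open>q ^ M = 1\<close> False by (simp add: sum_gp_strict)
  qed
  finally show ?thesis .
qed

text \<open>Discrete Parseval: |(z + w \<omega>)^k|^2 expands into a double sum over exponents at
  most k < M, and orthogonality keeps only the diagonal.\<close>

lemma roots_unity_avg_norm_power:
  fixes z w :: complex
  assumes "k < M"
  shows "(\<Sum>i<M. cmod (z + w * cis (2 * pi * real i / M)) ^ (2 * k)) / M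
    = (\<Sum>j\<le>k. (real (k choose j))\<^sup>2 * cmod w ^ (2 * j) * cmod z ^ (2 * (k - j)))"
proof -
  define c where "c j = of_nat (k choose j) * w ^ j * z ^ (k - j)" for j
  define \<omega> where "\<omega> i = cis (2 * pi * real i / M)" for i
  have "complex_of_real (cmod (z + w * \<omega> i) ^ (2 * k))
      = (\<Sum>j\<le>k. \<Sum>l\<le>k. c j * cnj (c l) * (\<omega> i ^ j * cnj (\<omega> i ^ l)))" for i
  proof -
    have "(z + w * \<omega> i) ^ k = (\<Sum>j\<le>k. c j * \<omega> i ^ j)"
      by (subst add.commute, subst binomial_ring)
        (simp add: c_def power_mult_distrib mult_ac)
    moreover have "cmod (z + w * \<omega> i) ^ (2 * k) = (cmod ((z + w * \<omega> i) ^ k))\<^sup>2"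
      by (simp only: norm_power mult.commute[of 2] power_mult)
    then have "complex_of_real (cmod (z + w * \<omega> i) ^ (2 * k))
        = (z + w * \<omega> i) ^ k * cnj ((z + w * \<omega> i) ^ k)"
      by (simp only: complex_norm_square)
    ultimately show ?thesis
      by (simp add: sum_product mult_ac)
  qed
  then have "complex_of_real (\<Sum>i<M. cmod (z + w * \<omega> i) ^ (2 * k))
      = (\<Sum>i<M. \<Sum>j\<le>k. \<Sum>l\<le>k. c j * cnj (c l) * (\<omega> i ^ j * cnj (\<omega> i ^ l)))"
    by (simp only: of_real_sum)
  also have "\<dots> = (\<Sum>j\<le>k. \<Sum>l\<le>k. c j * cnj (c l) * (\<Sum>i<M. \<omega> i ^ j * cnj (\<omega> i ^ l)))"
    unfolding sum_distrib_left
    by (subst sum.swap, rule sum.cong[OF refl], rule sum.swap)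
  also have "\<dots> = (\<Sum>j\<le>k. \<Sum>l\<le>k. if j = l then c j * cnj (c l) * of_nat M else 0)"
    unfolding \<omega>_def using assms
    by (intro sum.cong refl) (subst sum_roots_unity_orthogonal, auto)
  also have "\<dots> = (\<Sum>j\<le>k. c j * cnj (c j) * of_nat M)"
    by (intro sum.cong refl) (simp add: sum.delta')
  also have "\<dots> = complex_of_real (\<Sum>j\<le>k. (cmod (c j))\<^sup>2 * M)"
    by (simp add: complex_norm_square[symmetric])
  finally have "(\<Sum>i<M. cmod (z + w * \<omega> i) ^ (2 * k)) = (\<Sum>j\<le>k. (cmod (c j))\<^sup>2) * M"
    by (simp only: of_real_eq_iff sum_distrib_right)
  also have "(\<Sum>j\<le>k. (cmod (c j))\<^sup>2)
      = (\<Sum>j\<le>k. (real (k choose j))\<^sup>2 * cmod w ^ (2 * j) * cmod z ^ (2 * (k - j)))"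
    by (intro sum.cong refl)
      (simp add: c_def norm_mult norm_power power_mult_distrib mult.commute[of 2] power_mult)
  finally show ?thesis using assms by (simp add: \<omega>_def)
qed

text \<open>Jordan's inequality, from concavity of the sine.\<close>

lemma sin_ge_chord:
  assumes "0 \<le> x" "x \<le> pi / 2"
  shows "sin x \<ge> 2 * x / pi"
proof -
  have "convex_on {0..pi / 2} (\<lambda>x. - sin x)"
    by (rule f''_ge0_imp_convex[of _ _ "\<lambda>x. - cos x" sin])
      (auto intro!: derivative_eq_intros sin_ge_zero)
  from convex_onD_Icc'[OF this, of x] assms show ?thesis
    by (simp add: field_simps)
qed

text \<open>Two admissible points differ by at most 2 r, while roots with index difference d are 2
  |sin (pi d / M)| apart. Jordan's inequality then forces d to lie within q of 0 modulo M.\<close>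

lemma card_roots_unity_near:
  fixes z w :: complex and M :: nat and r :: real
  assumes "w \<noteq> 0" "M > 0" "r \<ge> 0"
  shows "real (card {i \<in> {..<M}. cmod (z + w * cis (2 * pi * real i / M)) \<le> r}) \<le> M * r / cmod w + 1"
proof -
  define \<omega> where "\<omega> i = cis (2 * pi * real i / M)" for i
  define S where "S = {i \<in> {..<M}. cmod (z + w * \<omega> i) \<le> r}"
  define q where "q = nat \<lfloor>M * r / (2 * cmod w)\<rfloor>"
  have q: "real q \<le> M * r / (2 * cmod w)" using assms by (simp add: q_def)
  have fin: "finite S" by (simp add: S_def)
  have "card S \<le> 2 * q + 1"
  proof (cases "S = {}")
    case False
    \<comment> \<open>Anchoring at the least index keeps the truncated differences i - a
      faithful.\<close>
    define a where "a = Min S"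
    have a: "a \<in> S" "\<And>i. i \<in> S \<Longrightarrow> a \<le> i" using fin False by (auto simp: a_def)
    have "(\<lambda>i. i - a) ` S \<subseteq> {..q} \<union> {M - q..<M}"
    proof
      fix d assume "d \<in> (\<lambda>i. i - a) ` S"
      then obtain i where i: "i \<in> S" "d = i - a" by auto
      have iad: "i = a + d" "d < M" using a(2)[OF i(1)] i by (auto simp: S_def)
      have "\<omega> i = \<omega> a * cis (2 * pi * real d / M)"
        by (simp add: iad \<omega>_def cis_mult add_divide_distrib ring_distribs)
      then have "w * \<omega> i - w * \<omega> a = w * \<omega> a * (cis (2 * pi * real d / M) - 1)"
        by (simp add: algebra_simps)
      then have "cmod (w * \<omega> i - w * \<omega> a) = cmod w * cmod (cis (2 * pi * real d / M) - 1)"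
        by (simp add: norm_mult \<omega>_def)
      also have "cmod (cis (2 * pi * real d / M) - 1) = 2 * \<bar>sin (pi * real d / M)\<bar>"
        using dist_exp_i_1[of "2 * pi * real d / M"] by (simp add: cis_conv_exp)
      finally have "cmod (w * \<omega> i - w * \<omega> a) = cmod w * (2 * \<bar>sin (pi * real d / M)\<bar>)" .
      moreover have "cmod (w * \<omega> i - w * \<omega> a) \<le> 2 * r"
        using norm_triangle_ineq4[of "z + w * \<omega> i" "z + w * \<omega> a"] a(1) i(1) by (auto simp: S_def)
      ultimately have "cmod w * \<bar>sin (pi * real d / M)\<bar> \<le> r" by linarith
      then have "\<bar>sin (pi * real d / M)\<bar> \<le> r / cmod w"
        using assms by (simp add: pos_le_divide_eq mult.commute)
      then have sin: "sin (pi * real d / M) \<le> r / cmod w" by simp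
      have le_q: "e \<le> q" if "sin (pi * real e / M) \<le> r / cmod w" "2 * e \<le> M" for e :: nat
      proof -
        have "2 * (pi * real e / M) / pi \<le> sin (pi * real e / M)"
          using that(2) assms by (intro sin_ge_chord) (auto simp: field_simps simp flip: of_nat_mult)
        then have "2 * real e / M \<le> r / cmod w" using that(1) by simp
        then have "real e \<le> M * r / (2 * cmod w)" using assms by (simp add: field_simps)
        then show ?thesis unfolding q_def by (simp add: le_nat_floor)
      qed
      show "d \<in> {..q} \<union> {M - q..<M}"
      proof (cases "2 * d \<le> M")
        case True
        with le_q sin show ?thesis by auto
      next
        case False
        \<comment> \<open>Past the half turn, the symmetry sin (pi - x) = sin x replaces d by M -
          d.\<close>
        have "pi * real (M - d) / M = pi - pi * real d / M"
          using iad assms by (simp add: of_nat_diff field_simps)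
        with sin have "sin (pi * real (M - d) / M) \<le> r / cmod w" by simp
        from le_q[OF this] False have "M - d \<le> q" by simp
        then show ?thesis using iad by auto
      qed
    qed
    then have "card ((\<lambda>i. i - a) ` S) \<le> card ({..q} \<union> {M - q..<M})"
      by (intro card_mono) auto
    also have "\<dots> \<le> card {..q} + card {M - q..<M}" by (rule card_Un_le)
    also have "\<dots> \<le> 2 * q + 1" by simp
    also have "card ((\<lambda>i. i - a) ` S) = card S"
      by (intro card_image inj_onI) (metis a(2) le_add_diff_inverse)
    finally show ?thesis .
  qed simp
  then have "real (card S) \<le> 2 * real q + 1" by linarith
  also have "2 * real q \<le> M * r / cmod w" using q assms by (simp add: field_simps)
  finally show ?thesis by (simp add: S_def \<omega>_def)
qed

section \<open>Averages over tuples of roots of unity\<close>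

definition torus_avg :: "nat \<Rightarrow> 'a set \<Rightarrow> ('a \<Rightarrow> complex) \<Rightarrow> (complex \<Rightarrow> real) \<Rightarrow> real" where
  "torus_avg M A W f =
     (\<Sum>\<sigma>\<in>A \<rightarrow>\<^sub>E {..<M}. f (\<Sum>m\<in>A. W m * cis (2 * pi * real (\<sigma> m) / M))) / M ^ card A"

text \<open>A finite Fubini rule: the coordinate x is averaged first, with the others held
  fixed.\<close>

lemma torus_avg_insert:
  assumes "finite A" "x \<notin> A"
  shows "torus_avg M (insert x A) W f
    = torus_avg M A W (\<lambda>z. (\<Sum>i<M. f (z + W x * cis (2 * pi * real i / M))) / M)"
proof -
  let ?\<omega> = "\<lambda>i::nat. cis (2 * pi * real i / M)"
  have "(\<Sum>\<sigma>\<in>insert x A \<rightarrow>\<^sub>E {..<M}. f (\<Sum>m\<in>insert x A. W m * ?\<omega> (\<sigma> m)))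
      = (\<Sum>(i, \<sigma>)\<in>{..<M} \<times> (A \<rightarrow>\<^sub>E {..<M}). f (\<Sum>m\<in>insert x A. W m * ?\<omega> ((\<sigma>(x := i)) m)))"
    unfolding PiE_insert_eq
    by (subst sum.reindex[OF inj_combinator[OF assms(2)]]) (simp add: case_prod_unfold o_def)
  also have "\<dots> = (\<Sum>i<M. \<Sum>\<sigma>\<in>A \<rightarrow>\<^sub>E {..<M}. f ((\<Sum>m\<in>A. W m * ?\<omega> (\<sigma> m)) + W x * ?\<omega> i))"
    unfolding sum.cartesian_product[symmetric]
  proof (intro sum.cong refl arg_cong[where f = f])
    fix i :: nat and \<sigma>
    have "(\<Sum>m\<in>A. W m * ?\<omega> ((\<sigma>(x := i)) m)) = (\<Sum>m\<in>A. W m * ?\<omega> (\<sigma> m))"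
      using assms by (intro sum.cong) auto
    then show "(\<Sum>m\<in>insert x A. W m * ?\<omega> ((\<sigma>(x := i)) m)) = (\<Sum>m\<in>A. W m * ?\<omega> (\<sigma> m)) + W x * ?\<omega> i"
      using assms by (simp add: add.commute)
  qed
  also have "\<dots> = (\<Sum>\<sigma>\<in>A \<rightarrow>\<^sub>E {..<M}. \<Sum>i<M. f ((\<Sum>m\<in>A. W m * ?\<omega> (\<sigma> m)) + W x * ?\<omega> i))"
    by (rule sum.swap)
  finally show ?thesis
    using assms by (simp add: torus_avg_def sum_divide_distrib divide_divide_eq_left)
qed

lemma torus_avg_sum: "torus_avg M A W (\<lambda>z. \<Sum>j\<in>I. f j z) = (\<Sum>j\<in>I. torus_avg M A W (f j))"
  unfolding torus_avg_def by (subst sum.swap) (simp add: sum_divide_distrib)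

lemma torus_avg_add: "torus_avg M A W (\<lambda>z. f z + g z) = torus_avg M A W f + torus_avg M A W g"
  by (simp add: torus_avg_def sum.distrib add_divide_distrib)

lemma torus_avg_cmult: "torus_avg M A W (\<lambda>z. c * f z) = c * torus_avg M A W f"
  by (simp add: torus_avg_def sum_distrib_left)

lemma torus_avg_const: "finite A \<Longrightarrow> M > 0 \<Longrightarrow> torus_avg M A W (\<lambda>z. c) = c"
  by (simp add: torus_avg_def card_PiE)

text \<open>By the triangle inequality the sampled points lie in this disc, so f and g need
  comparing only there.\<close>

lemma torus_avg_mono:
  assumes "\<And>z. cmod z \<le> (\<Sum>m\<in>A. cmod (W m)) \<Longrightarrow> f z \<le> g z"
  shows "torus_avg M A W f \<le> torus_avg M A W g"
  unfolding torus_avg_def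
proof (intro divide_right_mono sum_mono assms)
  fix \<sigma>
  have "cmod (\<Sum>m\<in>A. W m * cis (2 * pi * real (\<sigma> m) / M)) \<le> (\<Sum>m\<in>A. cmod (W m * cis (2 * pi * real (\<sigma> m) / M)))"
    by (rule norm_sum)
  then show "cmod (\<Sum>m\<in>A. W m * cis (2 * pi * real (\<sigma> m) / M)) \<le> (\<Sum>m\<in>A. cmod (W m))"
    by (simp add: norm_mult)
qed simp

lemma abs_torus_avg_le: "\<bar>torus_avg M A W f\<bar> \<le> torus_avg M A W (\<lambda>z. \<bar>f z\<bar>)"
  unfolding torus_avg_def by (auto intro!: divide_right_mono sum_abs)

section \<open>Moments and small-ball mass\<close>

text \<open>Forcing l to vanish off A represents compositions over A by functions on the whole type,
  which permits induction on A.\<close>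

definition moment_sum :: "'a set \<Rightarrow> ('a \<Rightarrow> complex) \<Rightarrow> nat \<Rightarrow> real" where
  "moment_sum A W k = (\<Sum>l | (\<forall>m. m \<notin> A \<longrightarrow> l m = 0) \<and> (\<Sum>m\<in>A. l m) = k.
     \<Prod>m\<in>A. cmod (W m) ^ (2 * l m) / (fact (l m))\<^sup>2)"

lemma finite_compositions_on:
  fixes A :: "'a set"
  assumes "finite A"
  shows "finite {l :: 'a \<Rightarrow> nat. (\<forall>m. m \<notin> A \<longrightarrow> l m = 0) \<and> (\<Sum>m\<in>A. l m) = k}"
proof (rule finite_subset)
  show "{l :: 'a \<Rightarrow> nat. (\<forall>m. m \<notin> A \<longrightarrow> l m = 0) \<and> (\<Sum>m\<in>A. l m) = k}
      \<subseteq> {l. \<forall>m. (m \<in> A \<longrightarrow> l m \<in> {..k}) \<and> (m \<notin> A \<longrightarrow> l m = 0)}"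
    using assms by (auto intro: member_le_sum)
  show "finite {l :: 'a \<Rightarrow> nat. \<forall>m. (m \<in> A \<longrightarrow> l m \<in> {..k}) \<and> (m \<notin> A \<longrightarrow> l m = 0)}"
    using assms by (intro finite_set_of_finite_funs) auto
qed

text \<open>Compositions are sorted by their entry j at x, which is then reset to 0.\<close>

lemma moment_sum_insert:
  fixes A :: "'a set"
  assumes "finite A" "x \<notin> A"
  shows "moment_sum (insert x A) W k
    = (\<Sum>j\<le>k. cmod (W x) ^ (2 * j) / (fact j)\<^sup>2 * moment_sum A W (k - j))"
proof -
  define C where "C A k = {l :: 'a \<Rightarrow> nat. (\<forall>m. m \<notin> A \<longrightarrow> l m = 0) \<and> (\<Sum>m\<in>A. l m) = k}" for A k
  define p where "p l = (\<Prod>m\<in>A. cmod (W m) ^ (2 * l m) / (fact (l m))\<^sup>2)" for l :: "'a \<Rightarrow> nat"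
  have upd: "(\<Sum>m\<in>A. (l(x := j)) m) = (\<Sum>m\<in>A. l m)" "p (l(x := j)) = p l" 
    "(\<Sum>m\<in>A. if m = x then j else l m) = (\<Sum>m\<in>A. l m)" for l :: "'a \<Rightarrow> nat" and j
    unfolding p_def using assms by (auto intro!: sum.cong prod.cong)
  have "moment_sum (insert x A) W k
      = (\<Sum>l\<in>C (insert x A) k. cmod (W x) ^ (2 * l x) / (fact (l x))\<^sup>2 * p l)"
    using assms by (simp add: moment_sum_def C_def p_def)
  also have "\<dots> = (\<Sum>(j, l)\<in>(SIGMA j:{..k}. C A (k - j)). cmod (W x) ^ (2 * j) / (fact j)\<^sup>2 * p l)"
  proof (rule sum.reindex_bij_witness[where
        i = "\<lambda>(j, l). l(x := j)" and j = "\<lambda>l. (l x, l(x := 0))"])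
    fix l assume l: "l \<in> C (insert x A) k"
    then have "l x + (\<Sum>m\<in>A. l m) = k" using assms by (simp add: C_def)
    then have "l x \<le> k" "(\<Sum>m\<in>A. l m) = k - l x" by auto
    then show "(l x, l(x := 0)) \<in> (SIGMA j:{..k}. C A (k - j))"
      using l by (auto simp: C_def upd)
  next
    fix jl assume "jl \<in> (SIGMA j:{..k}. C A (k - j))"
    then show "(case jl of (j, l) \<Rightarrow> l(x := j)) \<in> C (insert x A) k"
      using assms by (auto simp: C_def upd)
    show "((case jl of (j, l) \<Rightarrow> l(x := j)) x, (case jl of (j, l) \<Rightarrow> l(x := j))(x := 0)) = jl"
      using \<open>jl \<in> _\<close> assms by (auto simp: C_def)
  qed (auto simp: upd)
  also have "\<dots> = (\<Sum>j\<le>k. \<Sum>l\<in>C A (k - j). cmod (W x) ^ (2 * j) / (fact j)\<^sup>2 * p l)"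
    using assms by (subst sum.Sigma) (auto simp: C_def intro: finite_compositions_on)
  finally show ?thesis
    by (simp only: moment_sum_def C_def p_def sum_distrib_left)
qed

text \<open>Induction on A: both sides obey the same convolution, as the squared binomial splits
  into squared factorials. The exponent drops to k - j, so k stays arbitrary.\<close>

lemma torus_avg_norm_power:
  assumes "finite A" "k < M"
  shows "torus_avg M A W (\<lambda>z. cmod z ^ (2 * k)) = (fact k)\<^sup>2 * moment_sum A W k"
  using assms
proof (induction A arbitrary: k rule: finite_induct)
  case empty
  have "{l :: 'a \<Rightarrow> nat. \<forall>m. l m = 0} = {\<lambda>_. 0}" by auto
  then show ?case by (simp add: torus_avg_def moment_sum_def power_0_left)
next
  case (insert x A)
  have "torus_avg M (insert x A) W (\<lambda>z. cmod z ^ (2 * k))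
      = (\<Sum>j\<le>k. (real (k choose j))\<^sup>2 * cmod (W x) ^ (2 * j) * torus_avg M A W (\<lambda>z. cmod z ^ (2 * (k - j))))"
    using insert.prems
    by (simp only: torus_avg_insert[OF insert.hyps] roots_unity_avg_norm_power torus_avg_sum torus_avg_cmult)
  also have "\<dots> = (\<Sum>j\<le>k. (fact k)\<^sup>2 * (cmod (W x) ^ (2 * j) / (fact j)\<^sup>2 * moment_sum A W (k - j)))"
  proof (intro sum.cong refl)
    fix j assume "j \<in> {..k}"
    then have "real (k choose j) = fact k / (fact j * fact (k - j))"
      by (simp add: binomial_fact)
    then show "(real (k choose j))\<^sup>2 * cmod (W x) ^ (2 * j) * torus_avg M A W (\<lambda>z. cmod z ^ (2 * (k - j)))
        = (fact k)\<^sup>2 * (cmod (W x) ^ (2 * j) / (fact j)\<^sup>2 * moment_sum A W (k - j))"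
      using insert.prems by (simp add: insert.IH power_divide power_mult_distrib)
  qed
  finally show ?case
    by (simp only: moment_sum_insert[OF insert.hyps] sum_distrib_left)
qed

lemma a_coeff_eq_moment_sum: "a_coeff k D = (fact k)\<^sup>2 * moment_sum UNIV (($) D) k"
  by (simp add: a_coeff_def moment_sum_def multinomial_def sum_distrib_left prod_dividef
      power_divide prod_power_distrib)

text \<open>Averaging over one coordinate with nonzero coefficient suffices, since the counting
  bound is uniform in the contribution z of the others.\<close>

lemma torus_avg_small_ball:
  assumes "finite A" "x \<in> A" "W x \<noteq> 0" "M > 0" "r \<ge> 0"
  shows "torus_avg M A W (\<lambda>z. of_bool (cmod z \<le> r)) \<le> r / cmod (W x) + 1 / M"
proof -
  have "torus_avg M (insert x (A - {x})) W (\<lambda>z. of_bool (cmod z \<le> r))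
      = torus_avg M (A - {x}) W (\<lambda>z. (\<Sum>i<M. of_bool (cmod (z + W x * cis (2 * pi * real i / M)) \<le> r)) / M)"
    using assms by (intro torus_avg_insert) auto
  also have "\<dots> \<le> torus_avg M (A - {x}) W (\<lambda>z. r / cmod (W x) + 1 / M)"
  proof (rule torus_avg_mono)
    fix z
    have "(\<Sum>i<M. of_bool (cmod (z + W x * cis (2 * pi * real i / M)) \<le> r) :: real)
        = card {i \<in> {..<M}. cmod (z + W x * cis (2 * pi * real i / M)) \<le> r}"
      by (simp add: of_bool_def sum.If_cases Int_def)
    also have "\<dots> \<le> M * r / cmod (W x) + 1"
      using assms by (intro card_roots_unity_near) auto
    finally show "(\<Sum>i<M. of_bool (cmod (z + W x * cis (2 * pi * real i / M)) \<le> r)) / M \<le> r / cmod (W x) + 1 / M"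
      using assms by (simp add: field_simps)
  qed
  also have "\<dots> = r / cmod (W x) + 1 / M"
    using assms by (intro torus_avg_const) auto
  also have "insert x (A - {x}) = A" using assms by auto
  finally show ?thesis .
qed

subsection \<open>Convergence of the series\<close>

text \<open>Only powers of |z|^2 up to N < M occur, so each averaged moment equals
  \<open>a_coeff\<close> exactly.\<close>

lemma torus_avg_gap_sum:
  fixes D :: "complex ^ 'm::finite"
  assumes "N < M"
  shows "torus_avg M UNIV (($) D) (\<lambda>z. gap_sum c N ((cmod z)\<^sup>2 / (norm D)\<^sup>2))
    = (\<Sum>j=1..N. 1 / real j * (\<Sum>k=0..j. real (j choose k) * ((- 1) ^ k * a_coeff k D / norm D ^ (2 * k)) *
        (1 / c ^ k - 1 / fact k)))"
proof -
  define e where "e j k = 1 / real j * (real (j choose k) * ((- 1) ^ k / norm D ^ (2 * k)) * (1 / c ^ k - 1 / fact k))"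
    for j k
  have expand: "(1 - (y :: real) / c) ^ j - laguerre j y = (\<Sum>k=0..j. real (j choose k) * (- 1) ^ k * (1 / c ^ k - 1 / fact k) * y ^ k)"
    for y j
  proof -
    have "(1 - y / c) ^ j = (\<Sum>k\<le>j. real (j choose k) * (- y / c) ^ k)"
      using binomial_ring[of "- y / c" 1 j] by (simp add: add.commute)
    then show ?thesis
      unfolding laguerre_def atLeast0AtMost
      by (simp only: sum_subtractf[symmetric])
        (intro sum.cong refl, simp add: power_divide power_minus' algebra_simps)
  qed
  have "gap_sum c N ((cmod z)\<^sup>2 / (norm D)\<^sup>2) = (\<Sum>j=1..N. \<Sum>k=0..j. e j k * cmod z ^ (2 * k))" for z
    unfolding gap_sum_def expand
    by (intro sum.cong refl) (simp add: e_def sum_divide_distrib power_divide mult_ac flip: power_mult)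
  then have "torus_avg M UNIV (($) D) (\<lambda>z. gap_sum c N ((cmod z)\<^sup>2 / (norm D)\<^sup>2))
      = (\<Sum>j=1..N. \<Sum>k=0..j. e j k * torus_avg M UNIV (($) D) (\<lambda>z. cmod z ^ (2 * k)))"
    by (simp only: torus_avg_sum torus_avg_cmult)
  also have "\<dots> = (\<Sum>j=1..N. \<Sum>k=0..j. e j k * a_coeff k D)"
    using assms by (intro sum.cong refl) (simp add: torus_avg_norm_power a_coeff_eq_moment_sum)
  also have "\<dots> = (\<Sum>j=1..N. 1 / real j * (\<Sum>k=0..j. real (j choose k) * ((- 1) ^ k * a_coeff k D / norm D ^ (2 * k)) *
        (1 / c ^ k - 1 / fact k)))"
    unfolding sum_distrib_left by (intro sum.cong refl) (simp add: e_def mult_ac)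
  finally show ?thesis .
qed

theorem corollary1:
  fixes n :: nat and D :: "complex ^ 'm::finite"
  assumes "n \<ge> 3" and "CARD('m) = n + 1" and "D \<noteq> 0"
  shows "(\<lambda>i. let j = Suc i in
            1 / real j *
            (\<Sum>k=0..j. real (j choose k) * ((- 1) ^ k * a_coeff k D / norm D ^ (2 * k)) *
               (1 / (real n + 1) ^ k - 1 / fact k)))
         sums (ln (real n + 1) + euler_mascheroni)"
proof -
  define c where "c = real n + 1"
  define K where "K = ln c + euler_mascheroni"
  have c: "c > 0" by (simp add: c_def)
  define gap where "gap N z = gap_sum c N ((cmod z)\<^sup>2 / (norm D)\<^sup>2)" for N z
  define avg where "avg N = torus_avg (Suc N) UNIV (($) D)" for N
  obtain x where x: "D $ x \<noteq> 0" using assms(3) by (auto simp: vec_eq_iff)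
  obtain B where B: "\<And>N y. 0 \<le> y \<Longrightarrow> y \<le> c \<Longrightarrow> N \<ge> 1 \<Longrightarrow> \<bar>gap_sum c N y - K\<bar> \<le> B"
    using gap_sum_bounded[OF c] unfolding K_def by blast
  obtain \<epsilon> where \<epsilon>: "\<epsilon> \<longlonglongrightarrow> 0"
    "\<And>N y. 1 / sqrt N \<le> y \<Longrightarrow> y \<le> c \<Longrightarrow> N \<ge> 1 \<Longrightarrow> \<bar>gap_sum c N y - K\<bar> \<le> \<epsilon> N"
    using gap_sum_uniform_limit[OF c] unfolding K_def by blast
  \<comment> \<open>The radius at which |z|^2 / \<parallel>D\<parallel>^2 equals 1 / sqrt N, the
    threshold of the uniform estimate.\<close>
  define r where "r N = norm D / sqrt (sqrt (real N))" for N
  have B0: "B \<ge> 0" using B[of 0 1] c by simp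
  have bound: "\<bar>avg N (gap N) - K\<bar> \<le> \<bar>\<epsilon> N\<bar> + B * (r N / cmod (D $ x) + 1 / Suc N)" if N: "N \<ge> 1" for N
  proof -
    \<comment> \<open>Outside the small ball the uniform error applies; inside it only the bound B,
      charged to the mass of the ball.\<close>
    have pw: "\<bar>gap N z + - K\<bar> \<le> \<bar>\<epsilon> N\<bar> + B * of_bool (cmod z \<le> r N)"
      if z: "cmod z \<le> (\<Sum>m\<in>UNIV. cmod (D $ m))" for z
    proof -
      define y where "y = (cmod z)\<^sup>2 / (norm D)\<^sup>2"
      have "(cmod z)\<^sup>2 \<le> (\<Sum>m\<in>UNIV. cmod (D $ m))\<^sup>2"
        using z by (intro power_mono) auto
      also have "\<dots> \<le> (\<Sum>m\<in>UNIV. (cmod (D $ m))\<^sup>2) * (\<Sum>m\<in>(UNIV :: 'm set). 1\<^sup>2)"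
        using Cauchy_Schwarz_ineq_sum[of "\<lambda>m. cmod (D $ m)" "\<lambda>_. 1" UNIV] by simp
      also have "\<dots> = (norm D)\<^sup>2 * c"
        by (simp add: norm_square_sum assms(2) c_def)
      finally have y: "0 \<le> y" "y \<le> c"
        using assms(3) by (auto simp: y_def field_simps)
      show ?thesis
      proof (cases "cmod z \<le> r N")
        case True
        then show ?thesis using B[OF y N] by (simp add: gap_def flip: y_def)
      next
        case False
        then have "(r N)\<^sup>2 \<le> (cmod z)\<^sup>2"
          by (intro power_mono) (auto simp: r_def)
        then have "1 / sqrt N \<le> y"
          using assms(3) N by (simp add: y_def r_def power_divide field_simps)
        from \<epsilon>(2)[OF this y(2) N] False show ?thesis by (simp add: gap_def flip: y_def)
      qed
    qed
    have "avg N (gap N) - K = avg N (\<lambda>z. gap N z + - K)"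
      unfolding avg_def torus_avg_add by (simp add: torus_avg_const)
    then have "\<bar>avg N (gap N) - K\<bar> \<le> avg N (\<lambda>z. \<bar>gap N z + - K\<bar>)"
      unfolding avg_def by (simp only: abs_torus_avg_le)
    also have "\<dots> \<le> avg N (\<lambda>z. \<bar>\<epsilon> N\<bar> + B * of_bool (cmod z \<le> r N))"
      unfolding avg_def by (intro torus_avg_mono pw)
    also have "\<dots> = \<bar>\<epsilon> N\<bar> + B * avg N (\<lambda>z. of_bool (cmod z \<le> r N))"
      unfolding avg_def by (simp add: torus_avg_add torus_avg_cmult torus_avg_const)
    also have "\<dots> \<le> \<bar>\<epsilon> N\<bar> + B * (r N / cmod (D $ x) + 1 / Suc N)"
      unfolding avg_def using x B0
      by (intro add_left_mono mult_left_mono torus_avg_small_ball) (auto simp: r_def)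
    finally show ?thesis .
  qed
  have "(\<lambda>N. B * (r N / cmod (D $ x) + 1 / Suc N)) \<longlonglongrightarrow> 0"
    unfolding r_def using x by real_asymp
  from tendsto_add[OF tendsto_rabs_zero[OF \<epsilon>(1)] this]
  have "(\<lambda>N. \<bar>\<epsilon> N\<bar> + B * (r N / cmod (D $ x) + 1 / Suc N)) \<longlonglongrightarrow> 0" by simp
  then have "(\<lambda>N. avg N (gap N) - K) \<longlonglongrightarrow> 0"
    by (rule Lim_null_comparison[rotated])
      (use bound in \<open>auto simp: eventually_at_top_linorder intro!: exI[of _ 1]\<close>)
  then have "(\<lambda>N. avg N (gap N)) \<longlonglongrightarrow> K" by (rule LIM_zero_cancel)
  \<comment> \<open>\<open>sums\<close> indexes from 0, hence the shift j = Suc i.\<close>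
  moreover have "avg N (gap N) = (\<Sum>i<N. let j = Suc i in
            1 / real j *
            (\<Sum>k=0..j. real (j choose k) * ((- 1) ^ k * a_coeff k D / norm D ^ (2 * k)) *
               (1 / (real n + 1) ^ k - 1 / fact k)))" for N
    unfolding avg_def gap_def Let_def torus_avg_gap_sum[OF lessI] c_def
    by (rule sum.reindex_bij_witness[of _ Suc "\<lambda>j. j - 1"]) auto
  ultimately show ?thesis unfolding sums_def K_def c_def by simp
qed

end
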